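(* There exist two universal constants $C,c>0$ such that, for every $h>0$, every $v\in\ell^2_h$ and every integer $j$, $$c\,2^j\|\delta_h^jv\|_{\ell^2_h}\le\|\mathcal D_h\delta_h^jv\|_{\ell^2_h}\le C\,2^j\|\delta_h^jv\|_{\ell^2_h}.$$
   Context: Let $h>0$. For a sequence $v=(v_n)_{n\in\mathbb Z}$ put $\|v\|_{\ell^2_h}^2:=h\sum_{n\in\mathbb Z}|v_n|^2$; $\ell^2_h$ is the set of sequences with finite norm. The central finite difference operator is $(\mathcal D_hv)_n:=\frac{v_{n+1}-v_{n-1}}{2h}$. The discrete Fourier transform of $v\in\ell^2_h$ is $\hat v(\xi)=\frac{h}{\sqrt{2\pi}}\sum_{n\in\mathbb Z}e^{-i\xi nh}v_n$, $\xi\in[-\frac\pi h,\frac\pi h]$, with inverse $(\mathcal F^{-1}g)_n=\frac1{\sqrt{2\pi}}\int_{-\pi/h}^{\pi/h}e^{i\xi nh}g(\xi)\,d\xi$. Dyadic decomposition: for $j\in\mathbb Z$ let $F_h(j):=\{\xi\in[-\frac\pi h,\frac\pi h]:\ |\frac{\sin(\xi h)}{h}|\in[\frac34 2^j,\frac43 2^{j+1}]\}$. Fix a family of measurable functions $\varphi_j:[-\frac\pi h,\frac\pi h]\to[0,1]$, $j\in\mathbb Z$ (depending on $h$), with $\mathrm{supp}(\varphi_j)\subseteq F_h(j)$ for all $j$ and $\sum_{j\in\mathbb Z}\varphi_j(\xi)=1$ for all $\xi\in[-\frac\pi h,\frac\pi h]$ with $\sin(\xi h)\ne0$. The localization operators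 are $\delta_h^jv:=\mathcal F^{-1}(\hat v\,\varphi_j)$ for $v\in\ell^2_h$. *)

theory Defs
  imports "HOL-Analysis.Analysis"
begin

text \<open>Sequences on the grid \<open>h\<int>\<close> are complex valued and indexed by \<^typ>\<open>int\<close>.\<close>

definition ell2 :: "(int \<Rightarrow> complex) set" where
  "ell2 = {v. (\<lambda>n. (cmod (v n))\<^sup>2) summable_on UNIV}"

text \<open>Meaningful on \<^const>\<open>ell2\<close> only: an infinite sum that does not converge is \<open>0\<close>.
  As \<open>h > 0\<close> is a constant factor, the set \<^const>\<open>ell2\<close> itself does not depend on \<open>h\<close>.\<close>

definition ell2_norm :: "real \<Rightarrow> (int \<Rightarrow> complex) \<Rightarrow> real" where
  "ell2_norm h v = sqrt (h * (\<Sum>\<^sub>\<infinity>n. (cmod (v n))\<^sup>2))"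

definition central_diff :: "real \<Rightarrow> (int \<Rightarrow> complex) \<Rightarrow> int \<Rightarrow> complex" where
  "central_diff h v n = (v (n + 1) - v (n - 1)) / complex_of_real (2 * h)"

definition freq :: "real \<Rightarrow> real set" where
  "freq h = {- pi / h..pi / h}"

definition dft_partial :: "real \<Rightarrow> (int \<Rightarrow> complex) \<Rightarrow> nat \<Rightarrow> real \<Rightarrow> complex" where
  "dft_partial h v N \<xi> = complex_of_real (h / sqrt (2 * pi)) *
     (\<Sum>n = - int N..int N. exp (- \<i> * complex_of_real (\<xi> * real_of_int n * h)) * v n)"

text \<open>For a square-summable sequence the series of the discrete Fourier transform need not
  converge absolutely; its sum is the limit in \<open>L\<^sup>2\<close> of the partial sums.  The limit is
  automatically square integrable, since the partial sums are, and is unique up to null sets.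
  \<open>dft\<close> picks one representative; \<open>inv_dft\<close> does not distinguish between them.\<close>

definition is_dft :: "real \<Rightarrow> (int \<Rightarrow> complex) \<Rightarrow> (real \<Rightarrow> complex) \<Rightarrow> bool" where
  "is_dft h v g \<longleftrightarrow>
     g \<in> borel_measurable (lebesgue_on (freq h)) \<and>
     (\<lambda>N. \<integral>\<^sup>+\<xi>. ennreal ((cmod (g \<xi> - dft_partial h v N \<xi>))\<^sup>2) \<partial>lebesgue_on (freq h))
       \<longlonglongrightarrow> 0"

definition dft :: "real \<Rightarrow> (int \<Rightarrow> complex) \<Rightarrow> real \<Rightarrow> complex" where
  "dft h v = (SOME g. is_dft h v g)"

definition inv_dft :: "real \<Rightarrow> (real \<Rightarrow> complex) \<Rightarrow> int \<Rightarrow> complex" where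
  "inv_dft h g n = complex_of_real (1 / sqrt (2 * pi)) *
     (LINT \<xi>|lebesgue_on (freq h). exp (\<i> * complex_of_real (\<xi> * real_of_int n * h)) * g \<xi>)"

definition dyadic_block :: "real \<Rightarrow> int \<Rightarrow> real set" where
  "dyadic_block h j =
     {\<xi> \<in> freq h. \<bar>sin (\<xi> * h) / h\<bar> \<in> {3 / 4 * 2 powi j..4 / 3 * 2 powi (j + 1)}}"

text \<open>Functions on \<open>freq h\<close> are total functions whose values outside \<open>freq h\<close> are ignored;
  the support is the closure of the set where the function does not vanish.\<close>

definition dyadic_partition :: "real \<Rightarrow> (int \<Rightarrow> real \<Rightarrow> real) \<Rightarrow> bool" where
  "dyadic_partition h \<phi> \<longleftrightarrow>
     (\<forall>j. \<phi> j \<in> borel_measurable (lebesgue_on (freq h)) \<and>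
          \<phi> j ` freq h \<subseteq> {0..1} \<and>
          closure {\<xi> \<in> freq h. \<phi> j \<xi> \<noteq> 0} \<subseteq> dyadic_block h j) \<and>
     (\<forall>\<xi>\<in>freq h. sin (\<xi> * h) \<noteq> 0 \<longrightarrow> ((\<lambda>j. \<phi> j \<xi>) has_sum 1) UNIV)"

definition localize ::
  "real \<Rightarrow> (int \<Rightarrow> real \<Rightarrow> real) \<Rightarrow> int \<Rightarrow> (int \<Rightarrow> complex) \<Rightarrow> int \<Rightarrow> complex" where
  "localize h \<phi> j v = inv_dft h (\<lambda>\<xi>. dft h v \<xi> * complex_of_real (\<phi> j \<xi>))"

end

theory Submission
  imports Defs
begin

text \<open>On the frequency side \<^const>\<open>central_diff\<close> multiplies by \<open>\<i> sin (\<xi> h) / h\<close>, whose modulus on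
  the dyadic block lies between \<open>3/4 \<cdot> 2\<^sup>j\<close> and \<open>8/3 \<cdot> 2\<^sup>j\<close>; the claim is then Parseval's identity for
  \<^const>\<open>inv_dft\<close>. The identity is proved for every integrable \<open>g\<close>, with both sides
  equal to the junk value \<open>0\<close> if \<open>g\<close> is not square integrable, so that the choice of the
  representative in \<^const>\<open>dft\<close> plays no role. For the inequality opposite to Bessel's, write
  \<open>a\<^sub>n = \<integral> e\<^sub>n g\<close> for the coefficients of \<open>g\<close> and \<open>B = h / (2\<pi>) \<Sum> |a\<^sub>n|\<^sup>2\<close>. Young's inequality gives
  \<open>2 Re \<integral> f g \<le> B + \<integral> |f|\<^sup>2\<close> for trigonometric polynomials \<open>f\<close>; it extends by Stone--Weierstrass to
  continuous periodic \<open>f\<close> and by dominated convergence to bounded measurable \<open>f\<close>. Taking for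
  \<open>f\<close> truncations of the conjugate of \<open>g\<close> yields \<open>\<integral> |g|\<^sup>2 \<le> B\<close>.\<close>

subsection \<open>Fourier modes and Bessel's inequality\<close>

text \<open>The characters of the grid, with the sign of \<open>inv_dft\<close>; all later
  computations use only their multiplicativity in \<open>n\<close>, their modulus 1 and their
  continuity, apart from the explicit integral and the sine formula.\<close>

definition mode :: "real \<Rightarrow> int \<Rightarrow> real \<Rightarrow> complex" where
  "mode h n \<xi> = exp (\<i> * complex_of_real (\<xi> * real_of_int n * h))"

lemma mode_0 [simp]: "mode h 0 \<xi> = 1"
  by (simp add: mode_def)

lemma mode_add: "mode h (m + n) \<xi> = mode h m \<xi> * mode h n \<xi>"
  by (simp add: mode_def algebra_simps flip: exp_add)

lemma mode_of_nat: "mode h (int n) \<xi> = mode h 1 \<xi> ^ n"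
  by (induction n) (simp_all add: mode_add)

lemma cnj_mode: "cnj (mode h n \<xi>) = mode h (- n) \<xi>"
  by (simp add: mode_def exp_cnj)

lemma norm_mode [simp]: "cmod (mode h n \<xi>) = 1"
  unfolding mode_def by (rule norm_exp_i_times)

lemma continuous_on_mode: "continuous_on S (mode h n)"
  unfolding mode_def by (intro continuous_intros)

lemma freq_eq: "freq h = {- (pi / h)..pi / h}"
  by (simp add: freq_def)

lemma borel_measurable_freq:
  "continuous_on (freq h) f \<Longrightarrow> f \<in> borel_measurable (lebesgue_on (freq h))"
  unfolding freq_def by (rule continuous_imp_measurable_on_sets_lebesgue) auto

lemma integrable_freq:
  fixes f :: "real \<Rightarrow> 'b::euclidean_space"
  assumes "continuous_on (freq h) f"
  shows "integrable (lebesgue_on (freq h)) f"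
  using assms unfolding freq_def by (rule continuous_imp_integrable_real)

lemma integrable_bounded_mult:
  fixes f g :: "'a \<Rightarrow> complex"
  assumes "integrable M g" "f \<in> borel_measurable M" "\<And>x. x \<in> space M \<Longrightarrow> cmod (f x) \<le> B"
  shows "integrable M (\<lambda>x. f x * g x)"
proof (rule Bochner_Integration.integrable_bound)
  show "integrable M (\<lambda>x. B * cmod (g x))"
    using assms(1) by auto
  show "(\<lambda>x. f x * g x) \<in> borel_measurable M"
    using assms(1,2) by auto
  show "AE x in M. norm (f x * g x) \<le> norm (B * cmod (g x))"
  proof (rule AE_I2)
    fix x assume "x \<in> space M"
    then have "cmod (f x) * cmod (g x) \<le> B * cmod (g x)"
      by (intro mult_right_mono assms(3)) auto
    then show "norm (f x * g x) \<le> norm (B * cmod (g x))"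
      by (simp add: norm_mult)
  qed
qed

lemma integrable_mode_mult:
  assumes "integrable (lebesgue_on (freq h)) g"
  shows "integrable (lebesgue_on (freq h)) (\<lambda>\<xi>. mode h n \<xi> * g \<xi>)"
  by (rule integrable_bounded_mult[where B=1])
     (auto intro: assms borel_measurable_freq continuous_on_mode)

text \<open>For \<open>n\<close> other than 0 the antiderivative \<open>exp (c * x) / c\<close>
  takes the same value at both end points, because the exponents differ by
  \<open>2 * pi * n * i\<close>.\<close>

lemma integral_mode:
  assumes "h > 0"
  shows "(LINT \<xi>|lebesgue_on (freq h). mode h n \<xi>) = (if n = 0 then of_real (2 * pi / h) else 0)"
proof -
  let ?L = "pi / h"
  have eq: "(LINT \<xi>|lebesgue_on (freq h). mode h n \<xi>) = integral {-?L..?L} (mode h n)"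
    unfolding freq_eq[symmetric]
    by (rule lebesgue_integral_eq_integral[OF integrable_freq[OF continuous_on_mode]])
       (simp add: freq_def)
  show ?thesis
  proof (cases "n = 0")
    case True
    then have "mode h n = (\<lambda>_. 1)" by auto
    with True assms show ?thesis unfolding eq by (simp add: scaleR_conv_of_real)
  next
    case False
    define c where "c = \<i> * complex_of_real (real_of_int n * h)"
    have c: "c \<noteq> 0" using False assms by (simp add: c_def)
    have mode_c: "mode h n x = exp (c * of_real x)" for x
      by (simp add: mode_def c_def algebra_simps)
    have "((mode h n) has_integral exp (c * of_real ?L) / c - exp (c * of_real (- ?L)) / c) {-?L..?L}"
    proof (rule fundamental_theorem_of_calculus)
      fix x
      have "((\<lambda>z. exp (c * z) / c) has_field_derivative mode h n x) (at (of_real x))"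
        unfolding mode_c using c by (auto intro!: derivative_eq_intros)
      then show "((\<lambda>x. exp (c * of_real x) / c) has_vector_derivative mode h n x) (at x within {-?L..?L})"
        by (rule has_vector_derivative_real_field)
    qed (use assms in simp)
    moreover have "exp (c * of_real ?L) = exp (c * of_real (- ?L))"
    proof -
      have "c * of_real ?L = c * of_real (- ?L) + of_int n * (of_real (2 * pi)) * \<i>"
        using assms by (simp add: c_def field_simps)
      then show ?thesis
        by (metis (no_types, lifting) exp_eq of_int_mult of_real_mult of_real_of_int_eq mult.assoc mult.commute of_int_numeral)
    qed
    ultimately show ?thesis
      unfolding eq using False by (simp add: integral_unique)
  qed
qed

text \<open>The pairing is bilinear, without a conjugate, to match \<open>inv_dft\<close>. The
  prefactor is split off, so Parseval's identity carries the constant \<open>2 * pi / h\<close> on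
  the side of the integral.\<close>

definition coeff_freq :: "real \<Rightarrow> (real \<Rightarrow> complex) \<Rightarrow> int \<Rightarrow> complex" where
  "coeff_freq h g n = (LINT \<xi>|lebesgue_on (freq h). mode h n \<xi> * g \<xi>)"

lemma inv_dft_eq: "inv_dft h g n = complex_of_real (1 / sqrt (2 * pi)) * coeff_freq h g n"
  by (simp add: inv_dft_def coeff_freq_def mode_def)

text \<open>Expanding the square leaves only the diagonal, by orthogonality of the modes.
  Frequencies are given through an injective \<open>k\<close>, so that shifted polynomials with
  frequencies \<open>int i - int N\<close> fit without reindexing.\<close>

lemma integral_norm_sq_trig:
  assumes h: "h > 0" and I: "finite I" "inj_on k I"
  shows "(LINT \<xi>|lebesgue_on (freq h). (cmod (\<Sum>i\<in>I. p i * mode h (k i) \<xi>))\<^sup>2)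
    = 2 * pi / h * (\<Sum>i\<in>I. (cmod (p i))\<^sup>2)"
proof -
  let ?M = "lebesgue_on (freq h)"
  have int: "integrable ?M (\<lambda>\<xi>. p i * cnj (p l) * mode h (k i - k l) \<xi>)" for i l
    by (intro integrable_mult_right integrable_freq continuous_on_mode)
  have "complex_of_real (LINT \<xi>|?M. (cmod (\<Sum>i\<in>I. p i * mode h (k i) \<xi>))\<^sup>2)
      = (LINT \<xi>|?M. (\<Sum>i\<in>I. \<Sum>l\<in>I. p i * cnj (p l) * mode h (k i - k l) \<xi>))"
  proof -
    have "complex_of_real ((cmod (\<Sum>i\<in>I. p i * mode h (k i) \<xi>))\<^sup>2)
      = (\<Sum>i\<in>I. \<Sum>l\<in>I. p i * cnj (p l) * mode h (k i - k l) \<xi>)" for \<xi>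
      unfolding complex_norm_square cnj_sum sum_product
      by (intro sum.cong refl) (simp add: cnj_mode mode_add[of h _ "- _", simplified])
    then show ?thesis
      by (simp only: flip: integral_complex_of_real)
  qed
  also have "\<dots> = (\<Sum>i\<in>I. \<Sum>l\<in>I. p i * cnj (p l) * (LINT \<xi>|?M. mode h (k i - k l) \<xi>))"
    by (simp add: int Bochner_Integration.integral_sum)
  also have "\<dots> = (\<Sum>i\<in>I. \<Sum>l\<in>I. if l = i then p i * cnj (p l) * of_real (2 * pi / h) else 0)"
    using I(2) by (intro sum.cong refl) (auto simp: integral_mode[OF h] inj_on_def)
  also have "\<dots> = (\<Sum>i\<in>I. p i * cnj (p i) * of_real (2 * pi / h))"
    using I(1) by (simp add: sum.delta)
  also have "\<dots> = of_real (2 * pi / h * (\<Sum>i\<in>I. (cmod (p i))\<^sup>2))"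
    by (simp add: complex_norm_square sum_distrib_left mult.commute del: of_real_power)
  finally show ?thesis
    using of_real_eq_iff by blast
qed

lemma integral_mult_trig:
  assumes "integrable (lebesgue_on (freq h)) g" "finite I"
  shows "(LINT \<xi>|lebesgue_on (freq h). (\<Sum>i\<in>I. p i * mode h (k i) \<xi>) * g \<xi>)
    = (\<Sum>i\<in>I. p i * coeff_freq h g (k i))"
  using assms integrable_mode_mult[OF assms(1)]
  by (simp add: sum_distrib_right mult.assoc coeff_freq_def Bochner_Integration.integral_sum)

text \<open>Integrates \<open>2 * t * Re (S * g) <= |g|^2 + t^2 * |S|^2\<close>, where the pairing
  of \<open>S\<close> with \<open>g\<close> is exactly the sum \<open>A\<close> to be
  bounded.\<close>

lemma bessel_freq:
  assumes h: "h > 0" and g: "integrable (lebesgue_on (freq h)) g"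
    and g2: "integrable (lebesgue_on (freq h)) (\<lambda>\<xi>. (cmod (g \<xi>))\<^sup>2)" and F: "finite F"
  shows "(\<Sum>n\<in>F. (cmod (coeff_freq h g n))\<^sup>2)
    \<le> 2 * pi / h * (LINT \<xi>|lebesgue_on (freq h). (cmod (g \<xi>))\<^sup>2)"
proof -
  let ?M = "lebesgue_on (freq h)"
  define A where "A = (\<Sum>n\<in>F. (cmod (coeff_freq h g n))\<^sup>2)"
  \<comment> \<open>With this \<open>t\<close>, \<open>t * S\<close> is a partial Fourier sum of the
    conjugate of \<open>g\<close>, and the integral of \<open>t^2 * |S|^2\<close> is
    \<open>t * A\<close>, half of the left-hand side.\<close>
  define t where "t = h / (2 * pi)"
  have t: "t > 0" using h by (simp add: t_def)
  define S where "S \<xi> = (\<Sum>n\<in>F. cnj (coeff_freq h g n) * mode h n \<xi>)" for \<xi>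
  have S_cont: "continuous_on (freq h) S"
    unfolding S_def by (intro continuous_intros continuous_on_mode)
  have Sg: "integrable ?M (\<lambda>\<xi>. S \<xi> * g \<xi>)"
    using integrable_mode_mult[OF g] by (simp add: S_def sum_distrib_right mult.assoc)
  then have int: "integrable ?M (\<lambda>\<xi>. Re (S \<xi> * g \<xi>))"
    by (rule integrable_Re)
  have "(LINT \<xi>|?M. S \<xi> * g \<xi>) = of_real A"
    unfolding S_def A_def integral_mult_trig[OF g F]
    by (simp add: complex_norm_square mult.commute del: of_real_power)
  then have 1: "(LINT \<xi>|?M. Re (S \<xi> * g \<xi>)) = A"
    by (simp add: integral_Re[OF Sg] del: times_complex.sel)
  have 2: "(LINT \<xi>|?M. (cmod (S \<xi>))\<^sup>2) = 2 * pi / h * A"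
    unfolding S_def A_def by (subst integral_norm_sq_trig[OF h F]) auto
  have int2: "integrable ?M (\<lambda>\<xi>. (cmod (S \<xi>))\<^sup>2)"
    by (intro integrable_freq continuous_intros S_cont)
  have "2 * t * (LINT \<xi>|?M. Re (S \<xi> * g \<xi>)) = (LINT \<xi>|?M. 2 * t * Re (S \<xi> * g \<xi>))"
    by simp
  also have "\<dots> \<le> (LINT \<xi>|?M. (cmod (g \<xi>))\<^sup>2 + t\<^sup>2 * (cmod (S \<xi>))\<^sup>2)"
  proof (rule integral_mono)
    fix \<xi>
    have "2 * t * Re (S \<xi> * g \<xi>) \<le> 2 * t * (cmod (S \<xi>) * cmod (g \<xi>))"
      using complex_Re_le_cmod[of "S \<xi> * g \<xi>"] t by (simp add: norm_mult)
    also have "\<dots> \<le> (cmod (g \<xi>))\<^sup>2 + t\<^sup>2 * (cmod (S \<xi>))\<^sup>2"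
      using sum_squares_bound[of "cmod (g \<xi>)" "t * cmod (S \<xi>)"]
      by (simp add: power_mult_distrib algebra_simps)
    finally show "2 * t * Re (S \<xi> * g \<xi>) \<le> (cmod (g \<xi>))\<^sup>2 + t\<^sup>2 * (cmod (S \<xi>))\<^sup>2" .
  qed (use int int2 g2 in auto)
  also have "\<dots> = (LINT \<xi>|?M. (cmod (g \<xi>))\<^sup>2) + t\<^sup>2 * (2 * pi / h * A)"
    using int2 g2 by (simp add: 2)
  also have "t\<^sup>2 * (2 * pi / h * A) = t * A"
    using h by (simp add: t_def power2_eq_square field_simps)
  finally have "t * A \<le> (LINT \<xi>|?M. (cmod (g \<xi>))\<^sup>2)"
    unfolding 1 by (simp add: mult.commute)
  then show ?thesis
    using h unfolding A_def[symmetric] t_def by (simp add: field_simps)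
qed

subsection \<open>The converse of Bessel's inequality\<close>

text \<open>Works on coefficients only, so square integrability of \<open>g\<close> is not
  presupposed: each product \<open>p i * a i\<close> is split by Young's inequality with weight
  \<open>L = 2 * pi / h\<close>, which turns one sum into \<open>B\<close> and the other into the
  integral of \<open>|P|^2\<close>.\<close>

lemma young_trig:
  assumes h: "h > 0" and g: "integrable (lebesgue_on (freq h)) g"
    and A: "\<And>F. finite F \<Longrightarrow> (\<Sum>n\<in>F. (cmod (coeff_freq h g n))\<^sup>2) \<le> 2 * pi / h * B"
    and I: "finite I" "inj_on k I"
    and P: "\<And>\<xi>. P \<xi> = (\<Sum>i\<in>I. p i * mode h (k i) \<xi>)"
  shows "2 * Re (LINT \<xi>|lebesgue_on (freq h). P \<xi> * g \<xi>)
    \<le> B + (LINT \<xi>|lebesgue_on (freq h). (cmod (P \<xi>))\<^sup>2)"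
proof -
  define a where "a i = coeff_freq h g (k i)" for i
  define L where "L = 2 * pi / h"
  have L: "L > 0" using h by (simp add: L_def)
  have "2 * Re (LINT \<xi>|lebesgue_on (freq h). P \<xi> * g \<xi>) = (\<Sum>i\<in>I. 2 * Re (p i * a i))"
    unfolding P integral_mult_trig[OF g I(1)] by (simp only: Re_sum sum_distrib_left a_def)
  also have "\<dots> \<le> (\<Sum>i\<in>I. (cmod (a i))\<^sup>2 / L + L * (cmod (p i))\<^sup>2)"
  proof (rule sum_mono)
    fix i
    have "2 * Re (p i * a i) \<le> 2 * (cmod (p i) * cmod (a i))"
      using complex_Re_le_cmod[of "p i * a i"] by (simp add: norm_mult)
    also have "\<dots> = 2 * (cmod (a i) / sqrt L) * (sqrt L * cmod (p i))"
      using L by simp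
    also have "\<dots> \<le> (cmod (a i) / sqrt L)\<^sup>2 + (sqrt L * cmod (p i))\<^sup>2"
      by (rule sum_squares_bound)
    also have "\<dots> = (cmod (a i))\<^sup>2 / L + L * (cmod (p i))\<^sup>2"
      using L by (simp add: power_divide power_mult_distrib)
    finally show "2 * Re (p i * a i) \<le> (cmod (a i))\<^sup>2 / L + L * (cmod (p i))\<^sup>2" .
  qed
  also have "\<dots> = (\<Sum>n\<in>k ` I. (cmod (coeff_freq h g n))\<^sup>2) / L + L * (\<Sum>i\<in>I. (cmod (p i))\<^sup>2)"
    by (simp add: sum.distrib sum_divide_distrib sum_distrib_left sum.reindex[OF I(2)] a_def)
  also have "\<dots> \<le> B + L * (\<Sum>i\<in>I. (cmod (p i))\<^sup>2)"
    using A[OF finite_imageI[OF I(1)], of k] L unfolding L_def[symmetric]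
    by (simp add: divide_le_eq mult.commute)
  also have "L * (\<Sum>i\<in>I. (cmod (p i))\<^sup>2) = (LINT \<xi>|lebesgue_on (freq h). (cmod (P \<xi>))\<^sup>2)"
    unfolding P L_def by (rule integral_norm_sq_trig[OF h I, symmetric])
  finally show ?thesis .
qed


section \<open>Uniform approximation of periodic functions by trigonometric polynomials\<close>

text \<open>On the unit circle \<open>cnj z\<close> is \<open>1 / z\<close>, so a polynomial in
  \<open>Re z\<close> and \<open>Im z\<close> is a Laurent polynomial in \<open>z\<close>; the
  factor \<open>z ^ N\<close> clears its negative powers.\<close>

lemma real_polynomial_function_circle:
  assumes "real_polynomial_function (q :: complex \<Rightarrow> real)"
  shows "\<exists>p N. \<forall>z. cmod z = 1 \<longrightarrow> z ^ N * complex_of_real (q z) = poly p z"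
  using assms
proof induction
  case (linear f)
  \<comment> \<open>By real linearity \<open>f z = Re z * f 1 + Im z * f \<i>\<close>. Writing
    \<open>Im z\<close> as \<open>(z - cnj z) / (2 * \<i>)\<close> puts the factor
    \<open>1 / \<i> = - \<i>\<close> into \<open>b\<close>.\<close>
  define a b where "a = complex_of_real (f 1)" and "b = - \<i> * complex_of_real (f \<i>)"
  have "z * complex_of_real (f z) = poly [:(a - b) / 2, 0, (a + b) / 2:] z" if "cmod z = 1" for z
  proof -
    have "f z = f (Re z *\<^sub>R 1 + Im z *\<^sub>R \<i>)"
      by (rule arg_cong[of _ _ f]) (simp add: complex_eq_iff)
    also have "\<dots> = Re z * f 1 + Im z * f \<i>"
      using linear by (simp add: linear_simps)
    finally have fz: "complex_of_real (f z) = (z + cnj z) / 2 * a + (z - cnj z) / 2 * b"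
      by (simp add: a_def b_def complex_eq_iff)
    have zz: "z * cnj z = 1"
      using that by (simp flip: complex_norm_square)
    have "z * complex_of_real (f z)
        = (z * z + z * cnj z) / 2 * a + (z * z - z * cnj z) / 2 * b"
      unfolding fz by (simp add: field_simps)
    then show ?thesis
      unfolding zz by (simp add: field_simps)
  qed
  then show ?case
    by (intro exI[of _ "[:(a - b) / 2, 0, (a + b) / 2:]"] exI[of _ 1]) simp
next
  case (const c)
  show ?case
    by (intro exI[of _ "[:complex_of_real c:]"] exI[of _ 0]) simp
next
  case (add f g)
  then obtain p N q K where
    "\<And>z. cmod z = 1 \<Longrightarrow> z ^ N * complex_of_real (f z) = poly p z"
    "\<And>z. cmod z = 1 \<Longrightarrow> z ^ K * complex_of_real (g z) = poly q z"
    by metis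
  then show ?case
    by (intro exI[of _ "monom 1 K * p + monom 1 N * q"] exI[of _ "N + K"])
       (auto simp: poly_monom power_add algebra_simps)
next
  case (mult f g)
  then obtain p N q K where
    "\<And>z. cmod z = 1 \<Longrightarrow> z ^ N * complex_of_real (f z) = poly p z"
    "\<And>z. cmod z = 1 \<Longrightarrow> z ^ K * complex_of_real (g z) = poly q z"
    by metis
  note pq = this
  show ?case
    by (intro exI[of _ "p * q"] exI[of _ "N + K"])
       (auto simp: power_add pq[symmetric] algebra_simps)
qed

lemma polynomial_function_circle:
  assumes "polynomial_function (q :: complex \<Rightarrow> complex)"
  shows "\<exists>p N. \<forall>z. cmod z = 1 \<longrightarrow> z ^ N * q z = poly p z"
proof -
  have "real_polynomial_function (\<lambda>z. Re (q z))" "real_polynomial_function (\<lambda>z. Im (q z))"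
    using assms bounded_linear_Re bounded_linear_Im
    by (auto simp: polynomial_function_def o_def)
  then obtain p1 N1 p2 N2 where
    p: "\<And>z. cmod z = 1 \<Longrightarrow> z ^ N1 * complex_of_real (Re (q z)) = poly p1 z"
       "\<And>z. cmod z = 1 \<Longrightarrow> z ^ N2 * complex_of_real (Im (q z)) = poly p2 z"
    using real_polynomial_function_circle by metis
  have "z ^ (N1 + N2) * q z = poly (monom 1 N2 * p1 + monom \<i> N1 * p2) z" if "cmod z = 1" for z
  proof -
    have "z ^ (N1 + N2) * q z
        = z ^ (N1 + N2) * (complex_of_real (Re (q z)) + \<i> * complex_of_real (Im (q z)))"
      by (simp flip: complex_eq)
    then show ?thesis
      using p[OF that, symmetric] by (simp add: poly_monom power_add algebra_simps)
  qed
  then show ?thesis by blast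
qed

text \<open>Equal values at the end points make \<open>f\<close> a function \<open>F\<close> on the
  unit circle, where Stone-Weierstrass gives a polynomial in \<open>Re z\<close> and
  \<open>Im z\<close>. On the circle this is \<open>p z / z ^ N\<close>, whence the frequencies
  \<open>int i - int N\<close>.\<close>

lemma trig_approximation:
  assumes h: "h > 0" and f: "continuous_on (freq h) f" "f (- (pi / h)) = f (pi / h)" and e: "e > 0"
  obtains p N where "\<And>\<xi>. \<xi> \<in> freq h \<Longrightarrow>
    cmod (f \<xi> - (\<Sum>i\<le>degree p. coeff p i * mode h (int i - int N) \<xi>)) < e"
proof -
  \<comment> \<open>\<open>F\<close> is continuous because \<open>mode h 1\<close> is a closed map of the compact interval onto the circle.\<close>
  define F where "F z = f (Arg z / h)" for z
  have mode_1: "mode h 1 \<xi> = cis (\<xi> * h)" for \<xi>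
    by (simp add: mode_def cis_conv_exp)
  have F: "F (mode h 1 \<xi>) = f \<xi>" if \<xi>: "\<xi> \<in> freq h" for \<xi>
  \<comment> \<open>\<open>Arg\<close> takes values in the half-open interval from
    \<open>- pi\<close> to \<open>pi\<close>, so the left end point is sent to \<open>pi\<close>;
    only there is periodicity of \<open>f\<close> needed.\<close>
  proof (cases "\<xi> = - (pi / h)")
    case True
    then have "Arg (mode h 1 \<xi>) = pi"
      using h by (simp add: mode_1 Arg_eq_pi flip: cis_cnj)
    then show ?thesis
      using True f(2) by (simp add: F_def)
  next
    case False
    then have "- pi < \<xi> * h" "\<xi> * h \<le> pi"
      using \<xi> h by (auto simp: freq_eq field_simps)
    then have "Arg (mode h 1 \<xi>) = \<xi> * h"
      by (simp add: mode_1 Arg_cis)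
    then show ?thesis
      using h by (simp add: F_def)
  qed
  have circle: "\<exists>\<xi>\<in>freq h. z = mode h 1 \<xi>" if "z \<in> sphere 0 1" for z
  proof
    show "Arg z / h \<in> freq h"
      using h mpi_less_Arg[of z] Arg_le_pi[of z] by (auto simp: freq_eq divide_simps)
    show "z = mode h 1 (Arg z / h)"
      using h that cis_Arg[of z] by (cases "z = 0") (auto simp: mode_1 sgn_eq)
  qed
  have compact: "compact (freq h)"
    by (simp add: freq_def)
  have "continuous_on (sphere 0 1) F"
    unfolding continuous_on_closed_vimage[OF closed_sphere]
  proof (intro allI impI)
    fix B :: "complex set" assume "closed B"
    then have "compact (f -` B \<inter> freq h)"
      using f(1) compact continuous_on_closed_vimage[OF compact_imp_closed[OF compact], of f]
      by (metis bounded_Int closed_Int compact_eq_bounded_closed)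
    then have "compact (mode h 1 ` (f -` B \<inter> freq h))"
      by (intro compact_continuous_image continuous_on_mode)
    moreover have "mode h 1 ` (f -` B \<inter> freq h) = F -` B \<inter> sphere 0 1"
      using circle F by fastforce
    ultimately show "closed (F -` B \<inter> sphere 0 1)"
      using compact_imp_closed by metis
  qed
  then obtain q where q: "polynomial_function q" "\<And>z. z \<in> sphere 0 1 \<Longrightarrow> cmod (F z - q z) < e"
    using Stone_Weierstrass_polynomial_function[OF compact_sphere _ e] by metis
  obtain p N where pN: "\<And>z. cmod z = 1 \<Longrightarrow> z ^ N * q z = poly p z"
    using polynomial_function_circle[OF q(1)] by metis
  show thesis
  proof (rule that[of p N])
    fix \<xi> assume \<xi>: "\<xi> \<in> freq h"
    let ?z = "mode h 1 \<xi>"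
    have "q ?z = mode h (- int N) \<xi> * (mode h (int N) \<xi> * q ?z)"
      by (simp flip: mode_add mult.assoc)
    also have "mode h (int N) \<xi> * q ?z = poly p ?z"
      using pN[of ?z] by (simp add: mode_of_nat)
    finally have "q ?z = (\<Sum>i\<le>degree p. coeff p i * mode h (int i - int N) \<xi>)"
      using mode_add[of h "int _" "- int N" \<xi>]
      by (simp add: poly_altdef sum_distrib_left mode_of_nat algebra_simps)
    then show "cmod (f \<xi> - (\<Sum>i\<le>degree p. coeff p i * mode h (int i - int N) \<xi>)) < e"
      using q(2)[of ?z] F[OF \<xi>] by simp
  qed
qed

section \<open>Young's inequality beyond trigonometric polynomials\<close>

text \<open>Dominated convergence on both sides: \<open>K * |g|\<close> dominates the pairing, and
  the constant \<open>K^2\<close> dominates the squares, being integrable on the bounded interval.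
  Used once for uniform and once for almost everywhere limits.\<close>

lemma young_limit:
  assumes g: "integrable (lebesgue_on (freq h)) g"
    and u: "\<And>n. u n \<in> borel_measurable (lebesgue_on (freq h))"
    and bound: "\<And>n \<xi>. \<xi> \<in> freq h \<Longrightarrow> cmod (u n \<xi>) \<le> K"
    and f: "f \<in> borel_measurable (lebesgue_on (freq h))"
    and lim: "AE \<xi> in lebesgue_on (freq h). (\<lambda>n. u n \<xi>) \<longlonglongrightarrow> f \<xi>"
    and young: "\<And>n. 2 * Re (LINT \<xi>|lebesgue_on (freq h). u n \<xi> * g \<xi>)
      \<le> B + (LINT \<xi>|lebesgue_on (freq h). (cmod (u n \<xi>))\<^sup>2)"
  shows "2 * Re (LINT \<xi>|lebesgue_on (freq h). f \<xi> * g \<xi>)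
    \<le> B + (LINT \<xi>|lebesgue_on (freq h). (cmod (f \<xi>))\<^sup>2)"
proof (rule LIMSEQ_le)
  let ?M = "lebesgue_on (freq h)"
  have "(\<lambda>n. LINT \<xi>|?M. u n \<xi> * g \<xi>) \<longlonglongrightarrow> (LINT \<xi>|?M. f \<xi> * g \<xi>)"
  proof (rule integral_dominated_convergence[where w="\<lambda>\<xi>. K * cmod (g \<xi>)"])
    show "AE \<xi> in ?M. (\<lambda>n. u n \<xi> * g \<xi>) \<longlonglongrightarrow> f \<xi> * g \<xi>"
      using lim by eventually_elim (intro tendsto_intros)
    show "AE \<xi> in ?M. cmod (u n \<xi> * g \<xi>) \<le> K * cmod (g \<xi>)" for n
      by (rule AE_I2) (auto simp: norm_mult intro!: mult_right_mono bound)
  qed (use g u f in auto)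
  then show "(\<lambda>n. 2 * Re (LINT \<xi>|?M. u n \<xi> * g \<xi>)) \<longlonglongrightarrow> 2 * Re (LINT \<xi>|?M. f \<xi> * g \<xi>)"
    by (intro tendsto_intros)
  have "(\<lambda>n. LINT \<xi>|?M. (cmod (u n \<xi>))\<^sup>2) \<longlonglongrightarrow> (LINT \<xi>|?M. (cmod (f \<xi>))\<^sup>2)"
  proof (rule integral_dominated_convergence[where w="\<lambda>\<xi>. K\<^sup>2"])
    show "AE \<xi> in ?M. (\<lambda>n. (cmod (u n \<xi>))\<^sup>2) \<longlonglongrightarrow> (cmod (f \<xi>))\<^sup>2"
      using lim by eventually_elim (intro tendsto_intros)
    show "AE \<xi> in ?M. norm ((cmod (u n \<xi>))\<^sup>2) \<le> K\<^sup>2" for n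
      by (rule AE_I2) (auto intro!: power_mono bound)
  qed (use u f in \<open>auto intro: integrable_freq\<close>)
  then show "(\<lambda>n. B + (LINT \<xi>|?M. (cmod (u n \<xi>))\<^sup>2)) \<longlonglongrightarrow> B + (LINT \<xi>|?M. (cmod (f \<xi>))\<^sup>2)"
    by (intro tendsto_intros)
qed (use young in blast)

lemma young_continuous:
  assumes h: "h > 0" and g: "integrable (lebesgue_on (freq h)) g"
    and A: "\<And>F. finite F \<Longrightarrow> (\<Sum>n\<in>F. (cmod (coeff_freq h g n))\<^sup>2) \<le> 2 * pi / h * B"
    and f: "continuous_on (freq h) f" "f (- (pi / h)) = f (pi / h)"
  shows "2 * Re (LINT \<xi>|lebesgue_on (freq h). f \<xi> * g \<xi>)
    \<le> B + (LINT \<xi>|lebesgue_on (freq h). (cmod (f \<xi>))\<^sup>2)"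
proof -
  have "\<forall>n. \<exists>p N. \<forall>\<xi>\<in>freq h.
      cmod (f \<xi> - (\<Sum>i\<le>degree p. coeff p i * mode h (int i - int N) \<xi>)) < inverse (real (Suc n))"
    using trig_approximation[OF h f] by (metis inverse_positive_iff_positive of_nat_0_less_iff zero_less_Suc)
  then obtain p N where pN: "\<And>n \<xi>. \<xi> \<in> freq h \<Longrightarrow>
      cmod (f \<xi> - (\<Sum>i\<le>degree (p n). coeff (p n) i * mode h (int i - int (N n)) \<xi>))
        < inverse (real (Suc n))"
    by metis
  define u where "u n \<xi> = (\<Sum>i\<le>degree (p n). coeff (p n) i * mode h (int i - int (N n)) \<xi>)" for n \<xi>
  have u: "cmod (f \<xi> - u n \<xi>) < inverse (real (Suc n))" if "\<xi> \<in> freq h" for n \<xi>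
    using pN[OF that] by (simp add: u_def)
  have "bounded (f ` freq h)"
    using f(1) by (intro compact_imp_bounded compact_continuous_image) (simp_all add: freq_def)
  then obtain K where "\<forall>z\<in>f ` freq h. cmod z \<le> K"
    unfolding bounded_iff ..
  then have K: "cmod (f \<xi>) \<le> K" if "\<xi> \<in> freq h" for \<xi>
    using that by blast
  show ?thesis
  \<comment> \<open>The approximation errors \<open>1 / (n + 1)\<close> are at most 1, hence the
    common bound \<open>K + 1\<close>.\<close>
  proof (rule young_limit[OF g, where u=u and K="K + 1"])
    fix n \<xi> assume \<xi>: "\<xi> \<in> freq h"
    have "inverse (real (Suc n)) \<le> 1"
      by (simp add: field_simps)
    then show "cmod (u n \<xi>) \<le> K + 1"
      using u[OF \<xi>, of n] K[OF \<xi>] norm_triangle_sub[of "u n \<xi>" "f \<xi>"]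
      by (simp add: norm_minus_commute)
  next
    show "AE \<xi> in lebesgue_on (freq h). (\<lambda>n. u n \<xi>) \<longlonglongrightarrow> f \<xi>"
    proof (rule AE_I2)
      fix \<xi> assume "\<xi> \<in> space (lebesgue_on (freq h))"
      then have "norm (u n \<xi> - f \<xi>) \<le> inverse (real (Suc n))" for n
        using u[of \<xi> n] by (simp add: norm_minus_commute)
      then have "(\<lambda>n. u n \<xi> - f \<xi>) \<longlonglongrightarrow> 0"
        by (intro Lim_null_comparison[OF always_eventually LIMSEQ_inverse_real_of_nat] allI)
      then show "(\<lambda>n. u n \<xi>) \<longlonglongrightarrow> f \<xi>"
        by (rule LIM_zero_cancel)
    qed
  next
    fix n
    show "u n \<in> borel_measurable (lebesgue_on (freq h))"
      unfolding u_def by (intro borel_measurable_freq continuous_intros continuous_on_mode)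
    show "2 * Re (LINT \<xi>|lebesgue_on (freq h). u n \<xi> * g \<xi>)
      \<le> B + (LINT \<xi>|lebesgue_on (freq h). (cmod (u n \<xi>))\<^sup>2)"
      by (rule young_trig[OF h g A, where I="{..degree (p n)}" and k="\<lambda>i. int i - int (N n)"])
         (auto simp: u_def inj_on_def)
  qed (use borel_measurable_freq[OF f(1)] in auto)
qed

lemma AE_freq_negligible:
  assumes "negligible N"
  shows "AE \<xi> in lebesgue_on (freq h). \<xi> \<notin> N"
proof -
  have "AE \<xi> in lebesgue. \<xi> \<notin> N"
    using assms by (intro AE_not_in) (simp flip: negligible_iff_null_sets)
  then show ?thesis
    by (auto simp: AE_restrict_space_iff freq_def)
qed

text \<open>A measurable function is an almost everywhere limit of continuous \<open>w n\<close>.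
  These need be neither uniformly bounded nor periodic; clipping repairs the first and a cutoff the
  second, and neither changes the limit off a null set.\<close>

lemma young_bounded:
  assumes h: "h > 0" and g: "integrable (lebesgue_on (freq h)) g"
    and A: "\<And>F. finite F \<Longrightarrow> (\<Sum>n\<in>F. (cmod (coeff_freq h g n))\<^sup>2) \<le> 2 * pi / h * B"
    and f: "f \<in> borel_measurable (lebesgue_on (freq h))"
    and K: "\<And>\<xi>. \<xi> \<in> freq h \<Longrightarrow> cmod (f \<xi>) \<le> K" "K > 0"
  shows "2 * Re (LINT \<xi>|lebesgue_on (freq h). f \<xi> * g \<xi>)
    \<le> B + (LINT \<xi>|lebesgue_on (freq h). (cmod (f \<xi>))\<^sup>2)"
proof -
  have "f measurable_on freq h"
    using f by (subst measurable_on_iff_borel_measurable) (auto simp: freq_def)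
  then obtain N w where N: "negligible N" and w: "\<And>n. continuous_on UNIV (w n)"
    and lim: "\<And>\<xi>. \<xi> \<notin> N \<Longrightarrow> (\<lambda>n. w n \<xi>) \<longlonglongrightarrow> (if \<xi> \<in> freq h then f \<xi> else 0)"
    unfolding measurable_on_def by metis
  \<comment> \<open>The radial retraction onto the closed disc of radius \<open>K\<close>; the
    maximum keeps the denominator positive and the map continuous.\<close>
  define clip where "clip z = complex_of_real (K / max K (cmod z)) * z" for z
  have clip_cont: "continuous_on UNIV clip"
    unfolding clip_def using K(2) by (intro continuous_intros) (auto simp: max_def)
  have clip_le: "cmod (clip z) \<le> K" for z
  proof -
    have "K / max K (cmod z) * cmod z \<le> K"
      using K(2) by (auto simp: max_def field_simps)
    then show ?thesis
      using K(2) by (simp add: clip_def norm_mult max_def norm_divide split: if_splits)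
  qed
  have clip_id: "clip z = z" if "cmod z \<le> K" for z
    using that K(2) by (simp add: clip_def max_def)
  \<comment> \<open>forces the approximants to be periodic: \<open>cut\<close> vanishes at both end points\<close>
  define cut where "cut n \<xi> = min 1 (real n * (pi / h - \<bar>\<xi>\<bar>))" for n \<xi>
  have cut: "0 \<le> cut n \<xi>" "cut n \<xi> \<le> 1" if "\<xi> \<in> freq h" for n \<xi>
    using that by (auto simp: cut_def freq_eq intro!: mult_nonneg_nonneg)
  have cut_lim: "(\<lambda>n. cut n \<xi>) \<longlonglongrightarrow> 1" if "\<xi> \<in> freq h - {- (pi / h), pi / h}" for \<xi>
  proof -
    have "pi / h - \<bar>\<xi>\<bar> > 0"
      using that by (auto simp: freq_eq)
    then obtain m where m: "1 < real m * (pi / h - \<bar>\<xi>\<bar>)"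
      using ex_less_of_nat_mult by blast
    have "cut n \<xi> = 1" if "n \<ge> m" for n
    proof -
      have "real m * (pi / h - \<bar>\<xi>\<bar>) \<le> real n * (pi / h - \<bar>\<xi>\<bar>)"
        using \<open>pi / h - \<bar>\<xi>\<bar> > 0\<close> that by (intro mult_right_mono) auto
      then show ?thesis using m by (simp add: cut_def)
    qed
    then show ?thesis
      by (intro tendsto_eventually) (auto simp: eventually_sequentially)
  qed
  define u where "u n \<xi> = complex_of_real (cut n \<xi>) * clip (w n \<xi>)" for n \<xi>
  have u_cont: "continuous_on (freq h) (u n)" for n
    unfolding u_def cut_def
    by (intro continuous_intros continuous_on_compose2[OF clip_cont]
          continuous_on_subset[OF w]) auto
  show ?thesis
  proof (rule young_limit[OF g, where u=u and K=K])
    fix n \<xi> assume \<xi>: "\<xi> \<in> freq h"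
    have "\<bar>cut n \<xi>\<bar> * cmod (clip (w n \<xi>)) \<le> 1 * K"
      using cut[OF \<xi>] clip_le by (intro mult_mono) auto
    then show "cmod (u n \<xi>) \<le> K"
      by (simp add: u_def norm_mult)
  next
    \<comment> \<open>The cutoff is 0 at the end points for every \<open>n\<close>, so convergence
      to \<open>f\<close> may fail there and they join the exceptional set.\<close>
    have "negligible (N \<union> {- (pi / h), pi / h})"
      using N by auto
    then show "AE \<xi> in lebesgue_on (freq h). (\<lambda>n. u n \<xi>) \<longlonglongrightarrow> f \<xi>"
    proof (rule lebesgue_on_mono[OF AE_freq_negligible])
      fix \<xi> assume \<xi>: "\<xi> \<notin> N \<union> {- (pi / h), pi / h}" "\<xi> \<in> freq h"
      have "(\<lambda>n. clip (w n \<xi>)) \<longlonglongrightarrow> clip (f \<xi>)"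
        using lim[of \<xi>] \<xi> clip_cont
        by (auto intro: isCont_tendsto_compose simp: continuous_on_eq_continuous_at)
      moreover have "(\<lambda>n. complex_of_real (cut n \<xi>)) \<longlonglongrightarrow> of_real 1"
        using cut_lim \<xi> by (intro tendsto_of_real) auto
      ultimately show "(\<lambda>n. u n \<xi>) \<longlonglongrightarrow> f \<xi>"
        unfolding u_def using clip_id[OF K(1)[OF \<xi>(2)]] tendsto_mult by fastforce
    qed
  next
    fix n
    show "u n \<in> borel_measurable (lebesgue_on (freq h))"
      by (rule borel_measurable_freq[OF u_cont])
    show "2 * Re (LINT \<xi>|lebesgue_on (freq h). u n \<xi> * g \<xi>)
      \<le> B + (LINT \<xi>|lebesgue_on (freq h). (cmod (u n \<xi>))\<^sup>2)"
      by (rule young_continuous[OF h g A u_cont]) (use h in \<open>auto simp: u_def cut_def\<close>)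
  qed (rule f)
qed

text \<open>For a truncation \<open>f k\<close> of the conjugate of \<open>g\<close>, the pairing
  with \<open>g\<close> is the integral \<open>J k\<close> of \<open>|f k|^2\<close>. Young's
  inequality then reads \<open>2 * J k <= B + J k\<close>, and monotone convergence yields square
  integrability together with the bound.\<close>

lemma reverse_bessel_freq:
  assumes h: "h > 0" and g: "integrable (lebesgue_on (freq h)) g"
    and A: "\<And>F. finite F \<Longrightarrow> (\<Sum>n\<in>F. (cmod (coeff_freq h g n))\<^sup>2) \<le> 2 * pi / h * B"
  shows "integrable (lebesgue_on (freq h)) (\<lambda>\<xi>. (cmod (g \<xi>))\<^sup>2)"
    and "(LINT \<xi>|lebesgue_on (freq h). (cmod (g \<xi>))\<^sup>2) \<le> B"
proof -
  let ?M = "lebesgue_on (freq h)"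
  have gm [measurable]: "g \<in> borel_measurable ?M"
    using g by auto
  \<comment> \<open>Large values are replaced by 0 rather than clipped, so that
    \<open>f k * g = |f k|^2\<close> holds exactly. \<open>Suc k\<close> makes the bound positive,
    as \<open>young_bounded\<close> requires.\<close>
  define f where "f k \<xi> = (if cmod (g \<xi>) \<le> real (Suc k) then cnj (g \<xi>) else 0)" for k :: nat and \<xi>
  have "(\<lambda>\<xi>. cnj (g \<xi>)) \<in> borel_measurable ?M"
    using g by (intro borel_measurable_integrable) simp
  then have fm: "f k \<in> borel_measurable ?M" for k
    unfolding f_def by (intro measurable_If borel_measurable_le) auto
  have f_le: "cmod (f k \<xi>) \<le> real (Suc k)" for k \<xi>
    by (simp add: f_def)
  have fg: "f k \<xi> * g \<xi> = of_real ((cmod (f k \<xi>))\<^sup>2)" for k \<xi>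
    unfolding complex_norm_square by (simp add: f_def)
  have fi: "integrable ?M (\<lambda>\<xi>. (cmod (f k \<xi>))\<^sup>2)" for k
  proof -
    have "integrable ?M (\<lambda>\<xi>. f k \<xi> * g \<xi>)"
      by (rule integrable_bounded_mult[OF g fm f_le])
    then show ?thesis
      unfolding fg by (subst (asm) complex_of_real_integrable_eq)
  qed
  define J where "J k = (LINT \<xi>|?M. (cmod (f k \<xi>))\<^sup>2)" for k
  have J: "J k \<le> B" for k
  proof -
    have "(LINT \<xi>|?M. f k \<xi> * g \<xi>) = of_real (J k)"
      unfolding fg J_def by (rule integral_complex_of_real)
    moreover have "2 * Re (LINT \<xi>|?M. f k \<xi> * g \<xi>) \<le> B + J k"
      unfolding J_def by (rule young_bounded[OF h g A fm f_le]) auto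
    ultimately show ?thesis
      by simp
  qed
  have mono: "mono (\<lambda>k. (cmod (f k \<xi>))\<^sup>2)" for \<xi>
    by (rule monoI) (auto simp: f_def)
  have "incseq J"
    unfolding J_def using mono by (intro monoI integral_mono fi) (auto simp: mono_def)
  then obtain x where x: "J \<longlonglongrightarrow> x"
    using J by (metis incseq_convergent)
  have lim: "(\<lambda>k. (cmod (f k \<xi>))\<^sup>2) \<longlonglongrightarrow> (cmod (g \<xi>))\<^sup>2" for \<xi>
  proof (rule tendsto_eventually)
    obtain m where "cmod (g \<xi>) \<le> real m"
      using real_arch_simple by blast
    then have "(cmod (f k \<xi>))\<^sup>2 = (cmod (g \<xi>))\<^sup>2" if "k \<ge> m" for k
      using that by (auto simp: f_def)
    then show "\<forall>\<^sub>F k in sequentially. (cmod (f k \<xi>))\<^sup>2 = (cmod (g \<xi>))\<^sup>2"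
      by (auto simp: eventually_sequentially)
  qed
  note conv = fi AE_I2[OF mono] AE_I2[OF lim] x[unfolded J_def]
  show "integrable ?M (\<lambda>\<xi>. (cmod (g \<xi>))\<^sup>2)"
    by (rule integrable_monotone_convergence[OF conv]) measurable
  have "(LINT \<xi>|?M. (cmod (g \<xi>))\<^sup>2) = x"
    by (rule integral_monotone_convergence[OF conv]) measurable
  then show "(LINT \<xi>|?M. (cmod (g \<xi>))\<^sup>2) \<le> B"
    using LIMSEQ_le_const2[OF x] J by auto
qed

subsection \<open>Parseval's identity and the central difference\<close>

text \<open>Bessel's inequality gives one direction, and its converse with
  \<open>B = h / (2 * pi) * s\<close> the other.\<close>

lemma ell2_norm_inv_dft:
  assumes h: "h > 0" and g: "integrable (lebesgue_on (freq h)) g"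
  shows "ell2_norm h (inv_dft h g) = sqrt (LINT \<xi>|lebesgue_on (freq h). (cmod (g \<xi>))\<^sup>2)"
proof -
  let ?M = "lebesgue_on (freq h)"
  let ?a = "\<lambda>n. (cmod (coeff_freq h g n))\<^sup>2"
  define s where "s = infsum ?a UNIV"
  define J where "J = (LINT \<xi>|?M. (cmod (g \<xi>))\<^sup>2)"
  have norm: "ell2_norm h (inv_dft h g) = sqrt (h / (2 * pi) * s)"
  proof -
    have "(cmod (inv_dft h g n))\<^sup>2 = 1 / (2 * pi) * ?a n" for n
      by (simp add: inv_dft_eq norm_mult norm_divide power_mult_distrib power_divide)
    then show ?thesis
      unfolding ell2_norm_def s_def by (simp only: infsum_cmult_right') simp
  qed
  have reverse: "integrable ?M (\<lambda>\<xi>. (cmod (g \<xi>))\<^sup>2)" "J \<le> h / (2 * pi) * s" if "?a summable_on UNIV"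
  proof -
    have "sum ?a F \<le> 2 * pi / h * (h / (2 * pi) * s)" if "finite F" for F
      using finite_sum_le_infsum[OF \<open>?a summable_on UNIV\<close> that] h by (simp add: s_def)
    from reverse_bessel_freq[OF h g this]
    show "integrable ?M (\<lambda>\<xi>. (cmod (g \<xi>))\<^sup>2)" "J \<le> h / (2 * pi) * s"
      by (auto simp: J_def)
  qed
  show ?thesis
  proof (cases "integrable ?M (\<lambda>\<xi>. (cmod (g \<xi>))\<^sup>2)")
    case True
    note bessel = bessel_freq[OF h g True, folded J_def]
    have summable: "?a summable_on UNIV"
      using bessel by (intro nonneg_bdd_above_summable_on bdd_aboveI) auto
    have "s \<le> 2 * pi / h * J"
      unfolding s_def using bessel by (intro infsum_le_finite_sums summable)
    then have "h / (2 * pi) * s \<le> J"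
      using h by (simp add: field_simps)
    with reverse(2)[OF summable] show ?thesis
      unfolding norm J_def by simp
  next
    case False
    \<comment> \<open>Summable squared coefficients would make \<open>g\<close> square integrable,
      so here the sum takes its default value 0, as does the integral.\<close>
    then have "s = 0"
      using reverse(1) unfolding s_def by (metis infsum_not_exists)
    with False show ?thesis
      by (simp add: norm not_integrable_integral_eq)
  qed
qed

section \<open>The central difference on the frequency side\<close>

text \<open>A shift of the index by 1 or -1 multiplies the integrand by \<open>mode h 1\<close> or
  \<open>mode h (- 1)\<close>, and the difference of these two is
  \<open>2 * \<i> * sin (\<xi> * h)\<close>.\<close>

lemma central_diff_inv_dft:
  assumes h: "h > 0" and g: "integrable (lebesgue_on (freq h)) g"
  shows "central_diff h (inv_dft h g) = inv_dft h (\<lambda>\<xi>. \<i> * of_real (sin (\<xi> * h) / h) * g \<xi>)"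
proof
  fix n
  have "mode h (n + 1) \<xi> - mode h (n - 1) \<xi> = mode h n \<xi> * (2 * \<i> * of_real (sin (\<xi> * h)))" for \<xi>
  proof -
    have "mode h 1 \<xi> - mode h (- 1) \<xi> = 2 * \<i> * of_real (sin (\<xi> * h))"
      by (simp add: mode_def complex_eq_iff Re_exp Im_exp)
    then show ?thesis
      using mode_add[of h n 1 \<xi>] mode_add[of h n "- 1" \<xi>] by (simp add: algebra_simps)
  qed
  then have "coeff_freq h g (n + 1) - coeff_freq h g (n - 1)
      = (LINT \<xi>|lebesgue_on (freq h). mode h n \<xi> * (2 * \<i> * of_real (sin (\<xi> * h))) * g \<xi>)"
    unfolding coeff_freq_def
    by (subst Bochner_Integration.integral_diff[symmetric])
       (simp_all only: integrable_mode_mult[OF g] left_diff_distrib[symmetric])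
  also have "\<dots> = 2 * of_real h * coeff_freq h (\<lambda>\<xi>. \<i> * of_real (sin (\<xi> * h) / h) * g \<xi>) n"
    unfolding coeff_freq_def using h
    by (subst integral_mult_right_zero[symmetric])
       (intro Bochner_Integration.integral_cong refl, simp)
  finally have "coeff_freq h g (n + 1) - coeff_freq h g (n - 1)
    = 2 * of_real h * coeff_freq h (\<lambda>\<xi>. \<i> * of_real (sin (\<xi> * h) / h) * g \<xi>) n" .
  then show "central_diff h (inv_dft h g) n = inv_dft h (\<lambda>\<xi>. \<i> * of_real (sin (\<xi> * h) / h) * g \<xi>) n"
    unfolding central_diff_def inv_dft_eq right_diff_distrib[symmetric] using h by simp
qed

text \<open>Multiplication by \<open>mode h n\<close> is undone by \<open>mode h (- n)\<close>, so
  it cannot create integrability; every coefficient integral then has its default value 0.\<close>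

lemma inv_dft_not_integrable:
  assumes "\<not> integrable (lebesgue_on (freq h)) g"
  shows "inv_dft h g n = 0"
proof -
  have "\<not> integrable (lebesgue_on (freq h)) (\<lambda>\<xi>. mode h n \<xi> * g \<xi>)"
    using assms integrable_mode_mult[of h "\<lambda>\<xi>. mode h n \<xi> * g \<xi>" "- n"]
    by (auto simp flip: mult.assoc mode_add)
  then show ?thesis
    by (simp add: inv_dft_eq coeff_freq_def not_integrable_integral_eq)
qed

theorem proposition3p8:
  shows "\<exists>C c :: real. C > 0 \<and> c > 0 \<and>
    (\<forall>(h :: real) (\<phi> :: int \<Rightarrow> real \<Rightarrow> real).
       h > 0 \<longrightarrow> dyadic_partition h \<phi> \<longrightarrow>
       (\<forall>v \<in> ell2. \<forall>j :: int.
          c * 2 powi j * ell2_norm h (localize h \<phi> j v)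
            \<le> ell2_norm h (central_diff h (localize h \<phi> j v)) \<and>
          ell2_norm h (central_diff h (localize h \<phi> j v))
            \<le> C * 2 powi j * ell2_norm h (localize h \<phi> j v)))"
proof -
  \<comment> \<open>The constants are the end points of the dyadic block, with
    \<open>4 / 3 * 2 powi (j + 1)\<close> written as \<open>8 / 3 * 2 powi j\<close>.\<close>
  have main: "3 / 4 * 2 powi j * ell2_norm h (localize h \<phi> j v)
            \<le> ell2_norm h (central_diff h (localize h \<phi> j v)) \<and>
          ell2_norm h (central_diff h (localize h \<phi> j v))
            \<le> 8 / 3 * 2 powi j * ell2_norm h (localize h \<phi> j v)"
    if h: "h > 0" and \<phi>: "dyadic_partition h \<phi>" for h \<phi> v j
  proof -
    let ?M = "lebesgue_on (freq h)"
    define g where "g \<xi> = dft h v \<xi> * complex_of_real (\<phi> j \<xi>)" for \<xi>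
    have loc: "localize h \<phi> j v = inv_dft h g"
      by (simp add: localize_def g_def[abs_def])
    show ?thesis
    proof (cases "integrable ?M g")
      \<comment> \<open>The localized sequence and its central difference vanish identically, so
        both inequalities read \<open>0 <= 0\<close>.\<close>
      case False
      then show ?thesis
        by (simp add: loc inv_dft_not_integrable central_diff_def ell2_norm_def)
    next
      case True
      define m where "m \<xi> = \<bar>sin (\<xi> * h) / h\<bar>" for \<xi>
      define Dg where "Dg \<xi> = \<i> * of_real (sin (\<xi> * h) / h) * g \<xi>" for \<xi>
      define a where "a = 3 / 4 * (2 powi j :: real)"
      define b where "b = 8 / 3 * (2 powi j :: real)"
      have ab: "0 < a" "0 < b"
        by (simp_all add: a_def b_def)
      have Dg_int: "integrable ?M Dg"
        unfolding Dg_def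
      proof (rule integrable_bounded_mult[OF True])
        show "(\<lambda>\<xi>. \<i> * of_real (sin (\<xi> * h) / h)) \<in> borel_measurable ?M"
          using h by (intro borel_measurable_freq continuous_intros) auto
        show "cmod (\<i> * of_real (sin (\<xi> * h) / h)) \<le> 1 / h" for \<xi>
          using h by (simp add: norm_mult norm_divide divide_right_mono)
      qed
      have Dg_sq: "(cmod (Dg \<xi>))\<^sup>2 = (m \<xi>)\<^sup>2 * (cmod (g \<xi>))\<^sup>2" for \<xi>
        by (simp only: Dg_def m_def norm_mult norm_ii norm_of_real power_mult_distrib) simp
      \<comment> \<open>Where \<open>g\<close> is nonzero so is \<open>\<phi> j\<close>, and the
        support condition places the frequency in the block.\<close>
      have block: "a \<le> m \<xi> \<and> m \<xi> \<le> b" if "\<xi> \<in> freq h" "g \<xi> \<noteq> 0" for \<xi>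
      proof -
        have "\<xi> \<in> closure {\<xi> \<in> freq h. \<phi> j \<xi> \<noteq> 0}"
          using that closure_subset by (fastforce simp: g_def)
        then have "\<xi> \<in> dyadic_block h j"
          using \<phi> by (auto simp: dyadic_partition_def)
        then show ?thesis
          by (simp add: dyadic_block_def m_def a_def b_def power_int_add)
      qed
      have lower: "a\<^sup>2 * (cmod (g \<xi>))\<^sup>2 \<le> (cmod (Dg \<xi>))\<^sup>2"
        and upper: "(cmod (Dg \<xi>))\<^sup>2 \<le> b\<^sup>2 * (cmod (g \<xi>))\<^sup>2" if "\<xi> \<in> freq h" for \<xi>
        using block[OF that] ab unfolding Dg_sq
        by (cases "g \<xi> = 0"; auto intro!: mult_right_mono power_mono)+
      define J where "J = (LINT \<xi>|?M. (cmod (g \<xi>))\<^sup>2)"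
      define D where "D = (LINT \<xi>|?M. (cmod (Dg \<xi>))\<^sup>2)"
      have "a\<^sup>2 * J \<le> D \<and> D \<le> b\<^sup>2 * J"
      proof (cases "integrable ?M (\<lambda>\<xi>. (cmod (g \<xi>))\<^sup>2)")
        case g2: True
        have "integrable ?M (\<lambda>\<xi>. (cmod (Dg \<xi>))\<^sup>2)"
        proof (rule Bochner_Integration.integrable_bound)
          show "integrable ?M (\<lambda>\<xi>. b\<^sup>2 * (cmod (g \<xi>))\<^sup>2)"
            using g2 by simp
          show "AE \<xi> in ?M. norm ((cmod (Dg \<xi>))\<^sup>2) \<le> norm (b\<^sup>2 * (cmod (g \<xi>))\<^sup>2)"
            using upper by (intro AE_I2) simp
        qed (use Dg_int in auto)
        then show ?thesis
          using g2 lower upper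
            integral_mono[of ?M "\<lambda>\<xi>. a\<^sup>2 * (cmod (g \<xi>))\<^sup>2" "\<lambda>\<xi>. (cmod (Dg \<xi>))\<^sup>2"]
            integral_mono[of ?M "\<lambda>\<xi>. (cmod (Dg \<xi>))\<^sup>2" "\<lambda>\<xi>. b\<^sup>2 * (cmod (g \<xi>))\<^sup>2"]
          by (simp add: J_def D_def)
      next
        case g2: False
        \<comment> \<open>Since \<open>a > 0\<close>, the lower bound would pass square
          integrability from \<open>Dg\<close> to \<open>g\<close>. Hence both fail together, and
          \<open>J\<close> and \<open>D\<close> are both the default value 0.\<close>
        have "\<not> integrable ?M (\<lambda>\<xi>. (cmod (Dg \<xi>))\<^sup>2)"
        proof
          assume "integrable ?M (\<lambda>\<xi>. (cmod (Dg \<xi>))\<^sup>2)"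
          then have "integrable ?M (\<lambda>\<xi>. a\<^sup>2 * (cmod (g \<xi>))\<^sup>2)"
          proof (rule Bochner_Integration.integrable_bound)
            show "AE \<xi> in ?M. norm (a\<^sup>2 * (cmod (g \<xi>))\<^sup>2) \<le> norm ((cmod (Dg \<xi>))\<^sup>2)"
              using lower by (intro AE_I2) simp
          qed (use True in auto)
          with g2 ab show False by simp
        qed
        with g2 show ?thesis
          by (simp add: J_def D_def not_integrable_integral_eq)
      qed
      then have "sqrt (a\<^sup>2 * J) \<le> sqrt D \<and> sqrt D \<le> sqrt (b\<^sup>2 * J)"
        by simp
      then have "a * sqrt J \<le> sqrt D \<and> sqrt D \<le> b * sqrt J"
        using ab by (simp add: real_sqrt_mult)
      moreover have "central_diff h (localize h \<phi> j v) = inv_dft h Dg"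
        unfolding loc Dg_def by (rule central_diff_inv_dft[OF h True])
      ultimately show ?thesis
        unfolding loc[symmetric] using ell2_norm_inv_dft[OF h True] ell2_norm_inv_dft[OF h Dg_int]
        by (simp add: loc J_def D_def a_def b_def)
    qed
  qed
  show ?thesis
    by (intro exI[of _ "8 / 3"] exI[of _ "3 / 4"] conjI allI impI ballI) (use main in auto)
qed

end
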